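(* Let $N\ge 1$ and $m\ge 3$ be integers. If $\mathfrak P$ is a bounded convex polytope in $\mathbb R^N$ with $m$ facets and $n$ vertices, then \[ n\le \Lambda(N,m):=2\,h_{111}(m-1)\ \vee\ \big(h_{111}(m)+h_{221}(m-1)\big). \]
   Context: Notation: $a\vee b=\max\{a,b\}$, $a\wedge b=\min\{a,b\}$; binomial coefficients $\binom{a}{b}$ are taken to be $0$ when $b<0$ or $b>a$. Define $h_1(m,r):=\binom{m-r}{r}$ and $h_2(m,r):=\binom{m-r}{r-1}$, and \[ r_{11}(m)=\frac{5m-3-\sqrt{5m^2+10m+9}}{10},\qquad r_{21}(m)=\frac{5m+2-\sqrt{5m^2+4}}{10}. \] For $i,j\in\{1,2\}$ set \[ h_{ij1}(m):=h_i\big(m,\lfloor r_{j1}(m)\rfloor\wedge\lfloor N/2\rfloor\big)\ \vee\ h_i\big(m,\lceil r_{j1}(m)\rceil\wedge\lfloor N/2\rfloor\big) \] (so $h_{111}$ uses $h_1$ and $r_{11}$, and $h_{221}$ uses $h_2$ and $r_{21}$). A facet is a face of codimension one. *)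

theory Defs
  imports "HOL-Analysis.Analysis"
begin

definition binom_int :: "int \<Rightarrow> int \<Rightarrow> nat" where
  "binom_int a b = (if 0 \<le> b \<and> b \<le> a then nat a choose nat b else 0)"

definition h1 :: "int \<Rightarrow> int \<Rightarrow> nat" where
  "h1 m r = binom_int (m - r) r"

definition h2 :: "int \<Rightarrow> int \<Rightarrow> nat" where
  "h2 m r = binom_int (m - r) (r - 1)"

definition r11 :: "int \<Rightarrow> real" where
  "r11 m = (5 * m - 3 - sqrt (5 * m^2 + 10 * m + 9)) / 10"

definition r21 :: "int \<Rightarrow> real" where
  "r21 m = (5 * m + 2 - sqrt (5 * m^2 + 4)) / 10"

definition hij1 :: "(int \<Rightarrow> int \<Rightarrow> nat) \<Rightarrow> (int \<Rightarrow> real) \<Rightarrow> nat \<Rightarrow> int \<Rightarrow> nat" where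
  "hij1 h r N m = max (h m (min \<lfloor>r m\<rfloor> (int (N div 2)))) (h m (min \<lceil>r m\<rceil> (int (N div 2))))"

definition h111 :: "nat \<Rightarrow> int \<Rightarrow> nat" where "h111 = hij1 h1 r11"
definition h221 :: "nat \<Rightarrow> int \<Rightarrow> nat" where "h221 = hij1 h2 r21"

definition Lambda :: "nat \<Rightarrow> nat \<Rightarrow> nat" where
  "Lambda N m = max (2 * h111 N (int m - 1)) (h111 N (int m) + h221 N (int m - 1))"

end

theory Submission
  imports Defs "HOL-Library.Function_Algebras" "HOL-Computational_Algebra.Polynomial"
begin

text \<open>
  Fix a linear functional \<open>c\<close> that separates the vertices of the \<open>d\<close>-dimensional polytope \<open>P\<close>.
  At a vertex \<open>v\<close>, choose \<open>d\<close> facets through \<open>v\<close> with linearly independent outer normals and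
  expand \<open>c\<close> in these normals. Let \<open>D v\<close> and \<open>U v\<close> be the facets with positive and negative
  coefficients. Then \<open>v\<close> minimises \<open>c\<close> on the intersection of the facets in \<open>D v\<close> and
  maximises it on the intersection of those in \<open>U v\<close>. So, listing vertices by their value of
  \<open>c\<close>, the sets \<open>D v\<close> together with the sets of at most \<open>m - d\<close> facets missing \<open>v\<close> form a
  skew Bollobas system, and likewise the sets \<open>U v\<close> for the reverse order. As
  \<open>card (D v) + card (U v) \<le> d\<close>, every vertex has \<open>card (D v) \<le> d div 2\<close> or
  \<open>card (U v) \<le> d - 1 - d div 2\<close>, and the skew Bollobas theorem bounds the number of vertices
  of each kind. The sum of the two bounds is McMullen's upper bound; no perturbation to a simple
  polytope is needed. For \<open>d = 2 * k\<close> it equals \<open>h1 m k + h2 (m - 1) k\<close> and for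
  \<open>d = 2 * k + 1\<close> it equals \<open>2 * h1 (m - 1) k\<close>; both \<open>h1\<close> and \<open>h2\<close> are unimodal in \<open>k\<close>,
  with peaks located by \<open>r11\<close> and \<open>r21\<close>.
\<close>

subsection \<open>The skew Bollobas theorem\<close>

text \<open>Addition and zero of functions are the pointwise ones of
  \<open>Function_Algebras\<close>. Supplying the scalar multiplication makes span and dependence
  available for real functions on any type.\<close>

interpretation fun_space: vector_space "\<lambda>(c::real) (f::'a \<Rightarrow> real) x. c * f x"
  by unfold_locales (auto simp: fun_eq_iff algebra_simps)

lemma sum_fun_apply: "(\<Sum>i\<in>I. f i) x = (\<Sum>i\<in>I. f i x)" for f :: "'i \<Rightarrow> 'a \<Rightarrow> real"
  by (induction I rule: infinite_finite_induct) auto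

text \<open>In a nontrivial linear relation, take the index \<open>i\<close> with nonzero
  coefficient and largest \<open>f i\<close>. At \<open>y i\<close> all other terms vanish, smaller
  indices by \<open>tri\<close> and larger ones by maximality, while the term of \<open>i\<close>
  does not. So the \<open>g i\<close> are independent.\<close>

lemma card_le_of_triangular_evaluations:
  fixes g :: "'i \<Rightarrow> 'a \<Rightarrow> real" and y :: "'i \<Rightarrow> 'a" and f :: "'i \<Rightarrow> 'o::linorder"
  assumes "finite I" "inj_on f I" "finite T"
    and span: "\<And>i. i \<in> I \<Longrightarrow> g i \<in> fun_space.span T"
    and diag: "\<And>i. i \<in> I \<Longrightarrow> g i (y i) \<noteq> 0"
    and tri: "\<And>i j. i \<in> I \<Longrightarrow> j \<in> I \<Longrightarrow> f j < f i \<Longrightarrow> g j (y i) = 0"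
  shows "card I \<le> card T"
proof -
  have inj: "inj_on g I"
  proof (rule inj_onI, rule ccontr)
    fix i j assume ij: "i \<in> I" "j \<in> I" "g i = g j" "i \<noteq> j"
    then consider "f i < f j" | "f j < f i"
      using assms(2) by (metis inj_onD linorder_neqE)
    then show False using ij diag tri by cases metis+
  qed
  have "\<not> fun_space.dependent (g ` I)"
  proof
    assume "fun_space.dependent (g ` I)"
    then obtain u where u: "\<exists>i\<in>I. u (g i) \<noteq> 0"
        and 0: "(\<Sum>v\<in>g ` I. (\<lambda>x. u v * v x)) = 0"
      using \<open>finite I\<close> by (subst (asm) fun_space.dependent_finite) auto
    define J where "J = {i \<in> I. u (g i) \<noteq> 0}"
    have "finite (f ` J)" "f ` J \<noteq> {}" using u \<open>finite I\<close> by (auto simp: J_def)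
    from Max_in[OF this] obtain i where i: "i \<in> J" and "f i = Max (f ` J)" by auto
    with \<open>finite (f ` J)\<close> have max: "f j \<le> f i" if "j \<in> J" for j using that by simp
    have "(\<Sum>j\<in>I. u (g j) * g j (y i)) = 0"
      using 0 by (simp add: sum.reindex[OF inj] fun_eq_iff sum_fun_apply)
    moreover have "(\<Sum>j\<in>I. u (g j) * g j (y i)) = (\<Sum>j\<in>{i}. u (g j) * g j (y i))"
    proof (rule sum.mono_neutral_right)
      show "\<forall>j\<in>I - {i}. u (g j) * g j (y i) = 0"
      proof
        fix j assume j: "j \<in> I - {i}"
        show "u (g j) * g j (y i) = 0"
        proof (cases "j \<in> J")
          case True
          with max j i assms(2) have "f j < f i"
            by (metis (no_types, lifting) DiffE J_def inj_on_eq_iff insertI1 mem_Collect_eq order_le_imp_less_or_eq)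
          then show ?thesis using tri i j by (auto simp: J_def)
        qed (use j in \<open>auto simp: J_def\<close>)
      qed
    qed (use i \<open>finite I\<close> in \<open>auto simp: J_def\<close>)
    ultimately show False using i diag by (auto simp: J_def)
  qed
  then have "card (g ` I) \<le> card T"
    using fun_space.independent_span_bound[OF \<open>finite T\<close>] span by blast
  then show ?thesis by (simp add: card_image[OF inj])
qed

section \<open>Monomials of degree \<open>q\<close> in \<open>p + 1\<close> variables\<close>

definition monomials :: "nat \<Rightarrow> nat \<Rightarrow> ((nat \<Rightarrow> real) \<Rightarrow> real) set" where
  "monomials p q = (\<lambda>l y. \<Prod>k\<le>p. y k ^ (l ! k)) ` {l. length l = Suc p \<and> sum_list l = q}"

lemma finite_monomials: "finite (monomials p q)"
  and card_monomials_le: "card (monomials p q) \<le> (p + q) choose p"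
proof -
  have card: "card {l::nat list. length l = Suc p \<and> sum_list l = q} = (p + q) choose p"
    using card_length_sum_list[of "Suc p" q] binomial_symmetric[of p "p + q"]
    by (simp add: add.commute)
  \<comment> \<open>An infinite set would have cardinality 0, whereas the stars and bars count is
    positive.\<close>
  have "finite {l::nat list. length l = Suc p \<and> sum_list l = q}"
    using card by (intro card_ge_0_finite) simp
  then show "finite (monomials p q)" "card (monomials p q) \<le> (p + q) choose p"
    unfolding monomials_def card[symmetric] by (auto intro: card_image_le)
qed

lemma variable_times_span_monomials:
  assumes "f \<in> fun_space.span (monomials p q)" "k \<le> p"
  shows "(\<lambda>y. y k * f y) \<in> fun_space.span (monomials p (Suc q))"
  using assms(1)
proof (induction rule: fun_space.span_induct_alt)
  case base
  have "(\<lambda>y::nat\<Rightarrow>real. y k * (0::(nat\<Rightarrow>real)\<Rightarrow>real) y) = 0" by (simp add: fun_eq_iff)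
  then show ?case by (simp only: fun_space.span_zero)
next
  case (step c x z)
  then obtain l where l: "length l = Suc p" "sum_list l = q"
      and x: "x = (\<lambda>y. \<Prod>j\<le>p. y j ^ (l ! j))"
    by (auto simp: monomials_def)
  \<comment> \<open>Multiplying a monomial by \<open>y k\<close> raises its exponent at
    \<open>k\<close> by one.\<close>
  define l' where "l' = l[k := Suc (l ! k)]"
  have l': "length l' = Suc p" "sum_list l' = Suc q"
    using l assms(2) by (auto simp: l'_def sum_list_update elem_le_sum_list Suc_diff_le)
  have "(\<lambda>y. y k * x y) = (\<lambda>y. \<Prod>j\<le>p. y j ^ (l' ! j))"
  proof
    fix y :: "nat \<Rightarrow> real"
    have "(\<Prod>j\<in>{..p} - {k}. y j ^ (l' ! j)) = (\<Prod>j\<in>{..p} - {k}. y j ^ (l ! j))"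
      by (intro prod.cong) (auto simp: l'_def)
    then show "y k * x y = (\<Prod>j\<le>p. y j ^ (l' ! j))"
      using assms(2) l by (simp add: x prod.remove[of "{..p}" k] l'_def)
  qed
  then have "(\<lambda>y. y k * x y) \<in> monomials p (Suc q)"
    using l' by (auto simp: monomials_def)
  then have "(\<lambda>y. c * (y k * x y)) + (\<lambda>y. y k * z y) \<in> fun_space.span (monomials p (Suc q))"
    using step by (intro fun_space.span_add fun_space.span_scale) (auto intro: fun_space.span_base)
  moreover have "(\<lambda>y. c * (y k * x y)) + (\<lambda>y. y k * z y)
      = (\<lambda>y. y k * ((\<lambda>u. c * x u) + z) y)"
    by (simp add: fun_eq_iff algebra_simps)
  ultimately show ?case by simp
qed

lemma linear_form_times_span_monomials:
  assumes "f \<in> fun_space.span (monomials p q)"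
  shows "(\<lambda>y. (\<Sum>k\<le>p. y k * w k) * f y) \<in> fun_space.span (monomials p (Suc q))"
proof -
  have "(\<Sum>k\<le>p. (\<lambda>y. w k * (y k * f y))) \<in> fun_space.span (monomials p (Suc q))"
    using assms by (intro fun_space.span_sum fun_space.span_scale variable_times_span_monomials) auto
  moreover have "(\<Sum>k\<le>p. (\<lambda>y. w k * (y k * f y))) = (\<lambda>y. (\<Sum>k\<le>p. y k * w k) * f y)"
    by (auto simp: fun_eq_iff sum_fun_apply sum_distrib_left algebra_simps)
  ultimately show ?thesis by simp
qed

lemma prod_linear_forms_in_span_monomials:
  assumes "finite B"
  shows "(\<lambda>y. y p ^ r * (\<Prod>b\<in>B. \<Sum>k\<le>p. y k * w b k)) \<in> fun_space.span (monomials p (r + card B))"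
  using assms
proof (induction B rule: finite_induct)
  case empty
  have "(\<lambda>y. y p ^ r) \<in> fun_space.span (monomials p r)"
  proof (induction r)
    case 0
    have "(\<lambda>y::nat \<Rightarrow> real. y p ^ 0) \<in> monomials p 0"
      unfolding monomials_def
      by (rule image_eqI[of _ _ "replicate (Suc p) 0"]) (auto simp: fun_eq_iff simp del: replicate_Suc)
    then show ?case by (rule fun_space.span_base)
  next
    case (Suc r)
    then show ?case using variable_times_span_monomials[OF Suc, of p] by simp
  qed
  then show ?case by simp
next
  case (insert b B)
  then show ?case
    using linear_form_times_span_monomials[OF insert.IH, of "w b"] by (simp add: algebra_simps)
qed

text \<open>
  Polynomial method: embed the ground set in the nonnegative reals and encode \<open>A i\<close> by the monic
  polynomial \<open>Y i\<close> vanishing on it, padded to degree \<open>p\<close> by factors \<open>t + 1\<close>, which have no root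
  in the ground set. The product of the values of a polynomial over \<open>B j\<close> is a form in its
  \<open>p + 1\<close> coefficients, of degree \<open>q\<close> after padding by powers of the leading one; it vanishes at
  \<open>Y i\<close> exactly when \<open>A i\<close> meets \<open>B j\<close>. Hence these forms are linearly independent.
\<close>

theorem skew_Bollobas:
  fixes A B :: "'i \<Rightarrow> 'g set" and f :: "'i \<Rightarrow> 'o::linorder"
  assumes "finite I" "inj_on f I"
    and finA: "\<And>i. i \<in> I \<Longrightarrow> finite (A i)" and cardA: "\<And>i. i \<in> I \<Longrightarrow> card (A i) \<le> p"
    and finB: "\<And>i. i \<in> I \<Longrightarrow> finite (B i)" and cardB: "\<And>i. i \<in> I \<Longrightarrow> card (B i) \<le> q"
    and disj: "\<And>i. i \<in> I \<Longrightarrow> A i \<inter> B i = {}"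
    and meet: "\<And>i j. i \<in> I \<Longrightarrow> j \<in> I \<Longrightarrow> f j < f i \<Longrightarrow> A i \<inter> B j \<noteq> {}"
  shows "card I \<le> (p + q) choose p"
proof -
  define G where "G = (\<Union>i\<in>I. A i \<union> B i)"
  have "finite G" using assms by (auto simp: G_def)
  then obtain e0 :: "'g \<Rightarrow> nat" where "inj_on e0 G"
    using finite_imp_inj_to_nat_seg by metis
  define e where "e = (\<lambda>x. real (e0 x))"
  have e: "e x = e y \<longleftrightarrow> x = y" if "x \<in> G" "y \<in> G" for x y
    using that \<open>inj_on e0 G\<close> by (auto simp: e_def inj_on_eq_iff)
  define Y where "Y i = (\<Prod>a\<in>A i. [:- e a, 1:]) * [:1, 1:] ^ (p - card (A i))" for i
  have monic: "degree (Y i) = p" "coeff (Y i) p = 1" if "i \<in> I" for i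
  proof -
    have "lead_coeff (Y i) = 1"
      by (simp add: Y_def lead_coeff_mult lead_coeff_prod lead_coeff_power)
    moreover show "degree (Y i) = p"
      using cardA[OF that] finA[OF that]
      by (simp add: Y_def degree_mult_eq degree_prod_eq_sum_degree degree_power_eq)
    ultimately show "coeff (Y i) p = 1" by simp
  qed
  have poly_Y: "poly (Y i) (e x) = 0 \<longleftrightarrow> x \<in> A i" if "i \<in> I" "x \<in> G" for i x
  proof -
    have "1 + e x \<noteq> 0" by (simp add: e_def add_nonneg_eq_0_iff)
    moreover have "(\<exists>a\<in>A i. e x = e a) \<longleftrightarrow> x \<in> A i"
      using that e by (auto simp: G_def)
    ultimately show ?thesis
      using finA[OF that(1)] by (simp add: Y_def poly_prod)
  qed
  define g where "g j = (\<lambda>y. y p ^ (q - card (B j)) * (\<Prod>b\<in>B j. \<Sum>k\<le>p. y k * e b ^ k))" for j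
  have g_Y: "g j (coeff (Y i)) = 0 \<longleftrightarrow> A i \<inter> B j \<noteq> {}" if "i \<in> I" "j \<in> I" for i j
  proof -
    have "g j (coeff (Y i)) = (\<Prod>b\<in>B j. poly (Y i) (e b))"
      using monic[OF that(1)] by (simp add: g_def poly_altdef)
    also have "\<dots> = 0 \<longleftrightarrow> (\<exists>b\<in>B j. poly (Y i) (e b) = 0)"
      using finB[OF that(2)] by simp
    also have "\<dots> \<longleftrightarrow> A i \<inter> B j \<noteq> {}"
      using that poly_Y by (force simp: G_def)
    finally show ?thesis .
  qed
  have "card I \<le> card (monomials p q)"
  proof (rule card_le_of_triangular_evaluations[where g = g and y = "\<lambda>i. coeff (Y i)" and f = f])
    fix i assume "i \<in> I"
    then show "g i \<in> fun_space.span (monomials p q)"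
      using prod_linear_forms_in_span_monomials[of "B i" p "q - card (B i)" "\<lambda>b k. e b ^ k"] finB cardB
      by (simp add: g_def)
  qed (use assms g_Y finite_monomials in auto)
  also have "\<dots> \<le> (p + q) choose p" by (rule card_monomials_le)
  finally show ?thesis .
qed

subsection \<open>Facet normals and the vertex bound\<close>

text \<open>\<open>P\<close> may have smaller dimension than the space, so the normals are taken
  parallel to its affine hull. The minimal parallel representation of a polyhedron provides such
  normals, one for each facet.\<close>

lemma facet_supporting_halfspaceE:
  fixes P :: "'a::euclidean_space set"
  assumes "polyhedron P" "C facet_of P"
  obtains a b where "P \<subseteq> {x. a \<bullet> x \<le> b}" "C = P \<inter> {x. a \<bullet> x = b}"
    "\<And>x. x \<in> affine hull P \<Longrightarrow> x + a \<in> affine hull P"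
proof -
  obtain F where "finite F" and seq: "P = affine hull P \<inter> \<Inter>F"
    and faces: "\<forall>h\<in>F. \<exists>a b. a \<noteq> 0 \<and> h = {x. a \<bullet> x \<le> b} \<and>
        (\<forall>x\<in>affine hull P. x + a \<in> affine hull P)"
    and min: "\<And>F'. F' \<subset> F \<Longrightarrow> P \<subset> affine hull P \<inter> \<Inter>F'"
    using assms(1) unfolding polyhedron_Int_affine_parallel_minimal by meson
  from faces obtain a b where ab: "\<And>h. h \<in> F \<Longrightarrow> a h \<noteq> 0 \<and> h = {x. a h \<bullet> x \<le> b h}"
    and par: "\<And>h. h \<in> F \<Longrightarrow> \<forall>x\<in>affine hull P. x + a h \<in> affine hull P"
    by metis
  obtain h where "h \<in> F" and C: "C = P \<inter> {x. a h \<bullet> x = b h}"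
    using facet_of_polyhedron_explicit[OF \<open>finite F\<close> seq ab min] assms(2) by auto
  moreover have "P \<subseteq> {x. a h \<bullet> x \<le> b h}"
    using \<open>h \<in> F\<close> ab by (subst seq) auto
  ultimately show ?thesis using par that by blast
qed

text \<open>If \<open>y\<close> were outside \<open>P\<close>, the segment from a relative interior
  point \<open>x\<close> to \<open>y\<close> would leave \<open>P\<close> at a point
  \<open>z\<close> of some facet \<open>C\<close>. The inequality of \<open>C\<close> is strict at
  \<open>x\<close> and holds at \<open>y\<close>, hence is strict at \<open>z\<close>, contradicting
  \<open>z \<in> C\<close>.\<close>

lemma polytope_contains_of_facet_inequalities:
  fixes P :: "'a::euclidean_space set"
  assumes "polytope P" "P \<noteq> {}"
    and half: "\<And>C x. C facet_of P \<Longrightarrow> x \<in> P \<Longrightarrow> a C \<bullet> x \<le> b C"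
    and facet: "\<And>C. C facet_of P \<Longrightarrow> C = P \<inter> {x. a C \<bullet> x = b C}"
    and y: "y \<in> affine hull P" "\<And>C. C facet_of P \<Longrightarrow> a C \<bullet> y \<le> b C"
  shows "y \<in> P"
proof (rule ccontr)
  assume "y \<notin> P"
  have poly: "polyhedron P" and "bounded P" "closed P" "convex P"
    using assms(1) by (auto simp: polytope_imp_polyhedron polytope_imp_bounded polytope_imp_closed polytope_imp_convex)
  then obtain x where x: "x \<in> rel_interior P"
    using assms(2) rel_interior_eq_empty by blast
  then have "x \<in> P" using rel_interior_subset by blast
  with \<open>y \<notin> P\<close> have "y - x \<noteq> 0" by auto
  then obtain t where t: "0 < t" "x + t *\<^sub>R (y - x) \<in> rel_frontier P"
      "\<And>e. 0 \<le> e \<Longrightarrow> e < t \<Longrightarrow> x + e *\<^sub>R (y - x) \<in> rel_interior P"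
    using ray_to_rel_frontier[OF \<open>bounded P\<close> x, of "y - x"] y(1) by auto
  define z where "z = x + t *\<^sub>R (y - x)"
  have "\<not> 1 < t" using t(3)[of 1] \<open>y \<notin> P\<close> rel_interior_subset by force
  have z: "z \<in> P" "z \<notin> rel_interior P"
    using t(2) \<open>closed P\<close> by (auto simp: z_def rel_frontier_def)
  have "t \<noteq> 1" using z(1) \<open>y \<notin> P\<close> by (auto simp: z_def)
  with \<open>\<not> 1 < t\<close> have "t < 1" by linarith
  from z obtain C where C: "C facet_of P" "z \<in> C"
    using rel_boundary_of_polyhedron[OF poly] by blast
  have "x \<notin> C" using C x rel_boundary_of_polyhedron[OF poly] by blast
  then have "a C \<bullet> x \<noteq> b C" using facet[OF C(1)] \<open>x \<in> P\<close> by blast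
  then have "a C \<bullet> x < b C" using half[OF C(1) \<open>x \<in> P\<close>] by simp
  moreover have "a C \<bullet> y \<le> b C" using y(2) C(1) by blast
  moreover have "a C \<bullet> z = b C" using C facet by blast
  then have "(1 - t) * (a C \<bullet> x) + t * (a C \<bullet> y) = b C"
    by (simp add: z_def inner_simps algebra_simps)
  moreover have "(1 - t) * (a C \<bullet> x) < (1 - t) * b C" "t * (a C \<bullet> y) \<le> t * b C"
    using calculation \<open>t < 1\<close> t(1) by (auto intro: mult_left_mono)
  ultimately show False by (simp add: algebra_simps)
qed

text \<open>Along a nonzero \<open>u\<close> on which all tight normals vanish, one could move a
  little from \<open>v\<close> in both directions without leaving \<open>P\<close>, making
  \<open>v\<close> an inner point of a segment in \<open>P\<close>.\<close>

lemma extreme_point_tight_facet_normals: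
  fixes P :: "'a::euclidean_space set"
  assumes "polytope P" "v extreme_point_of P"
    and half: "\<And>C x. C facet_of P \<Longrightarrow> x \<in> P \<Longrightarrow> a C \<bullet> x \<le> b C"
    and facet: "\<And>C. C facet_of P \<Longrightarrow> C = P \<inter> {x. a C \<bullet> x = b C}"
    and u: "v + u \<in> affine hull P" "\<And>C. C facet_of P \<Longrightarrow> v \<in> C \<Longrightarrow> a C \<bullet> u = 0"
  shows "u = 0"
proof (rule ccontr)
  assume "u \<noteq> 0"
  have "v \<in> P" using assms(2) by (simp add: extreme_point_of_def)
  have fin: "finite {C. C facet_of P}" using assms(1) finite_polytope_facets by blast
  have "\<exists>e>0. \<bar>a C \<bullet> u\<bar> * e \<le> b C - a C \<bullet> v" if "C facet_of P" for C
  proof (cases "v \<in> C")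
    case True
    then have "a C \<bullet> v = b C" using facet[OF that] by blast
    then show ?thesis using that u(2) True by (intro exI[of _ 1]) auto
  next
    case False
    then have "a C \<bullet> v \<noteq> b C" using facet[OF that] \<open>v \<in> P\<close> by blast
    then have pos: "0 < b C - a C \<bullet> v" using half[OF that \<open>v \<in> P\<close>] by simp
    then show ?thesis
      \<comment> \<open>The step length is the slack divided by the speed; the added 1 keeps the
        divisor positive.\<close>
      by (intro exI[of _ "(b C - a C \<bullet> v) / (1 + \<bar>a C \<bullet> u\<bar>)"]) (auto simp: field_simps)
  qed
  then obtain e where e: "\<And>C. C facet_of P \<Longrightarrow> 0 < e C \<and> \<bar>a C \<bullet> u\<bar> * e C \<le> b C - a C \<bullet> v"
    by metis
  \<comment> \<open>The inserted 1 makes the minimum meaningful even if there are no facets.\<close>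
  define E where "E = Min (insert 1 (e ` {C. C facet_of P}))"
  have "0 < E" using fin e by (auto simp: E_def)
  have E: "\<bar>a C \<bullet> u\<bar> * E \<le> b C - a C \<bullet> v" if "C facet_of P" for C
  proof -
    have "E \<le> e C" using fin that by (auto simp: E_def)
    then have "\<bar>a C \<bullet> u\<bar> * E \<le> \<bar>a C \<bullet> u\<bar> * e C" by (intro mult_left_mono) auto
    then show ?thesis using e[OF that] by linarith
  qed
  have aff: "v + s *\<^sub>R u \<in> affine hull P" for s
  proof -
    have "(1 - s) *\<^sub>R v + s *\<^sub>R (v + u) \<in> affine hull P"
      using \<open>v \<in> P\<close> u(1) by (intro mem_affine[OF affine_affine_hull]) (auto intro: hull_inc)
    then show ?thesis by (simp add: algebra_simps)
  qed
  have mem: "v + s *\<^sub>R u \<in> P" if "\<bar>s\<bar> = E" for s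
  proof (rule polytope_contains_of_facet_inequalities[OF assms(1) _ half facet aff])
    fix C assume C: "C facet_of P"
    have "s * (a C \<bullet> u) \<le> \<bar>a C \<bullet> u\<bar> * E"
      by (metis abs_le_D1 abs_mult mult.commute order_refl that)
    with E[OF C] show "a C \<bullet> (v + s *\<^sub>R u) \<le> b C" by (simp add: inner_simps)
  qed (use \<open>v \<in> P\<close> in auto)
  have "v \<in> open_segment (v + E *\<^sub>R u) (v + (- E) *\<^sub>R u)"
    unfolding in_segment
    using \<open>0 < E\<close> \<open>u \<noteq> 0\<close>
    by (auto intro!: exI[of _ "1/2"] simp: algebra_simps simp flip: scaleR_add_left)
  then show False
    using mem[of E] mem[of "- E"] \<open>0 < E\<close> assms(2) by (auto simp: extreme_point_of_def)
qed

text \<open>By \<open>sep\<close> no nonzero vector of \<open>L\<close> is orthogonal to all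
  \<open>a i\<close>, so these span \<open>L\<close> and contain a basis, indexed by
  \<open>J\<close>. Only the component of \<open>c\<close> in \<open>L\<close> matters on
  \<open>L\<close>, and it expands in this basis.\<close>

lemma subspace_normal_representation:
  fixes a :: "'i \<Rightarrow> 'a::euclidean_space"
  assumes "subspace L" "finite S" "a ` S \<subseteq> L"
    and sep: "\<And>u. u \<in> L \<Longrightarrow> (\<And>i. i \<in> S \<Longrightarrow> a i \<bullet> u = 0) \<Longrightarrow> u = 0"
  obtains J w where "J \<subseteq> S" "card J = dim L"
    "\<And>u. u \<in> L \<Longrightarrow> c \<bullet> u = (\<Sum>i\<in>J. w i * (a i \<bullet> u))"
proof -
  have sub: "span (a ` S) \<subseteq> L" using assms by (simp add: span_minimal)
  have eq: "span (a ` S) = L"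
  proof (rule ccontr)
    assume "span (a ` S) \<noteq> L"
    with sub have "span (a ` S) \<subset> span L" using assms(1) by (metis psubsetI span_eq_iff)
    then obtain u where "u \<noteq> 0" "u \<in> span L" "\<And>y. y \<in> span (a ` S) \<Longrightarrow> orthogonal u y"
      using orthogonal_to_subspace_exists_gen by blast
    moreover have "span L = L" using assms(1) by (simp add: span_eq_iff)
    ultimately show False
      using sep[of u] by (metis imageI inner_commute orthogonal_def span_base)
  qed
  obtain B where B: "B \<subseteq> a ` S" "independent B" "a ` S \<subseteq> span B" "card B = dim (a ` S)"
    by (rule basis_exists)
  then obtain J where J: "J \<subseteq> S" "inj_on a J" "B = a ` J"
    by (metis subset_image_inj)
  have "finite J" using J(1) assms(2) finite_subset by blast
  have "span B = L" using B eq by (metis span_mono span_span subset_antisym)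
  obtain x y where xy: "x \<in> L" "\<And>u. u \<in> L \<Longrightarrow> y \<bullet> u = 0" "c = x + y"
    using orthogonal_subspace_decomp_exists[of L c] assms(1)
    by (metis orthogonal_def span_eq_iff)
  then obtain r where "x = (\<Sum>v\<in>B. r v *\<^sub>R v)"
    using \<open>span B = L\<close> span_finite[of B] \<open>finite J\<close> J(3) by auto
  then have "x = (\<Sum>i\<in>J. r (a i) *\<^sub>R a i)" using J by (simp add: sum.reindex)
  then have "c \<bullet> u = (\<Sum>i\<in>J. r (a i) * (a i \<bullet> u))" if "u \<in> L" for u
    using xy that by (simp add: inner_simps inner_sum_left)
  moreover have "card J = dim L"
    using B J eq by (metis card_image dim_span)
  ultimately show ?thesis using that[of J "\<lambda>i. r (a i)"] J(1) by simp
qed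

text \<open>The bad \<open>c\<close> lie in finitely many hyperplanes orthogonal to differences
  \<open>v - w\<close>, whose union is negligible.\<close>

lemma exists_functional_inj_on_finite:
  fixes V :: "'a::euclidean_space set"
  assumes "finite V"
  obtains c where "inj_on (\<lambda>v. c \<bullet> v) V"
proof -
  define N where "N = (\<Union>(v,w)\<in>{(v,w). v \<in> V \<and> w \<in> V \<and> v \<noteq> w}. {x. (v - w) \<bullet> x = 0})"
  have "finite {(v,w). v \<in> V \<and> w \<in> V \<and> v \<noteq> w}"
    by (rule finite_subset[of _ "V \<times> V"]) (use assms in auto)
  then have "negligible N"
    unfolding N_def by (intro negligible_Union) (auto intro!: negligible_hyperplane)
  then have "N \<noteq> UNIV" using non_negligible_UNIV by metis
  then obtain c where "c \<notin> N" by blast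
  then have "inj_on (\<lambda>v. c \<bullet> v) V"
    by (auto simp: N_def inj_on_def inner_simps inner_commute)
  then show ?thesis by (rule that)
qed

theorem card_extreme_points_le:
  fixes P :: "'a::euclidean_space set"
  assumes "polytope P" "aff_dim P = int d" "card {F. F facet_of P} = m"
  shows "d \<le> m"
    and "card {v. v extreme_point_of P} \<le> (m - d + d div 2 choose (d div 2))
      + (m - d + (d - 1 - d div 2) choose (d - 1 - d div 2))"
proof -
  define \<F> where "\<F> = {F. F facet_of P}"
  define V where "V = {v. v extreme_point_of P}"
  have poly: "polyhedron P" using assms(1) by (rule polytope_imp_polyhedron)
  have "finite \<F>" using assms(1) finite_polytope_facets by (auto simp: \<F>_def)
  have "finite V" using poly finite_polyhedron_extreme_points by (auto simp: V_def)
  have "P \<noteq> {}" using assms(2) by auto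
  then obtain z where "z \<in> P" by blast
  then have z: "z \<in> affine hull P" by (rule hull_inc)
  have "\<exists>a b. (\<forall>x\<in>P. a \<bullet> x \<le> b) \<and> C = P \<inter> {x. a \<bullet> x = b} \<and>
      (\<forall>x\<in>affine hull P. x + a \<in> affine hull P)" if "C \<in> \<F>" for C
  proof -
    have "C facet_of P" using that by (simp add: \<F>_def)
    then obtain a b where "P \<subseteq> {x. a \<bullet> x \<le> b}" "C = P \<inter> {x. a \<bullet> x = b}"
        "\<And>x. x \<in> affine hull P \<Longrightarrow> x + a \<in> affine hull P"
      using facet_supporting_halfspaceE[OF poly] by metis
    then show ?thesis by (intro exI[of _ a] exI[of _ b]) auto
  qed
  then obtain a b where half: "\<And>C x. C \<in> \<F> \<Longrightarrow> x \<in> P \<Longrightarrow> a C \<bullet> x \<le> b C"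
    and facet: "\<And>C. C \<in> \<F> \<Longrightarrow> C = P \<inter> {x. a C \<bullet> x = b C}"
    and par: "\<And>C x. C \<in> \<F> \<Longrightarrow> x \<in> affine hull P \<Longrightarrow> x + a C \<in> affine hull P"
    by metis
  \<comment> \<open>\<open>L\<close> is the direction space of the affine hull; it has dimension
    \<open>d\<close> and contains all the normals.\<close>
  define L where "L = (\<lambda>x. x - z) ` (affine hull P)"
  have "subspace L"
    unfolding L_def by (rule affine_diffs_subspace_subtract[OF affine_affine_hull z])
  have dimL: "dim L = d"
    using aff_dim_dim_affine_diffs[OF affine_affine_hull z] assms(2) by (simp add: L_def)
  have aL: "a C \<in> L" if "C \<in> \<F>" for C
    using par[OF that z] by (auto simp: L_def intro!: image_eqI[of _ _ "z + a C"])
  have diffL: "x - v \<in> L" if "x \<in> P" "v \<in> P" for x v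
  proof -
    have "x - z \<in> L" "v - z \<in> L" using that by (auto simp: L_def hull_inc)
    then have "(x - z) - (v - z) \<in> L" using \<open>subspace L\<close> by (rule subspace_diff[rotated])
    then show ?thesis by simp
  qed
  obtain c where c: "inj_on (\<lambda>v. c \<bullet> v) V"
    using exists_functional_inj_on_finite[OF \<open>finite V\<close>] .
  define S where "S v = {C \<in> \<F>. v \<in> C}" for v
  have VP: "v \<in> P" if "v \<in> V" for v using that by (simp add: V_def extreme_point_of_def)
  have "\<exists>J w. J \<subseteq> S v \<and> card J = d \<and> (\<forall>u\<in>L. c \<bullet> u = (\<Sum>i\<in>J. w i * (a i \<bullet> u)))"
    if "v \<in> V" for v
  proof -
    have "u = 0" if "u \<in> L" and tight: "\<And>C. C \<in> S v \<Longrightarrow> a C \<bullet> u = 0" for u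
    proof (rule extreme_point_tight_facet_normals[OF assms(1), of v a b])
      from \<open>u \<in> L\<close> obtain x where "x \<in> affine hull P" "u = x - z" by (auto simp: L_def)
      then have "v + u = v + 1 *\<^sub>R (x - z)" "v + 1 *\<^sub>R (x - z) \<in> affine hull P"
        using z VP[OF \<open>v \<in> V\<close>] mem_affine_3_minus[OF affine_affine_hull, of v P x z 1]
        by (auto simp: hull_inc)
      then show "v + u \<in> affine hull P" by simp
    qed (use half facet tight \<open>v \<in> V\<close> in \<open>auto simp: \<F>_def S_def V_def\<close>)
    moreover have "finite (S v)" "a ` S v \<subseteq> L" using \<open>finite \<F>\<close> aL by (auto simp: S_def)
    ultimately obtain J w where "J \<subseteq> S v" "card J = dim L"
      "\<And>u. u \<in> L \<Longrightarrow> c \<bullet> u = (\<Sum>i\<in>J. w i * (a i \<bullet> u))"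
      using subspace_normal_representation[OF \<open>subspace L\<close>, of "S v" a c] by blast
    then show ?thesis using dimL by auto
  qed
  then obtain J w where J: "\<And>v. v \<in> V \<Longrightarrow> J v \<subseteq> S v" "\<And>v. v \<in> V \<Longrightarrow> card (J v) = d"
    and w: "\<And>v u. v \<in> V \<Longrightarrow> u \<in> L \<Longrightarrow> c \<bullet> u = (\<Sum>i\<in>J v. w v i * (a i \<bullet> u))"
    by metis
  have finS: "finite (S v)" for v using \<open>finite \<F>\<close> by (simp add: S_def)
  have finJ: "finite (J v)" if "v \<in> V" for v using J(1)[OF that] finS finite_subset by blast
  have card_S: "d \<le> card (S v)" if "v \<in> V" for v
    using card_mono[OF finS J(1)[OF that]] J(2)[OF that] by simp
  have m: "m = card \<F>" using assms(3) by (simp add: \<F>_def)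
  \<comment> \<open>By Krein-Milman some vertex exists, and it already lies on at least
    \<open>d\<close> facets.\<close>
  have "V \<noteq> {}"
    using Krein_Milman_Minkowski[of P] assms(1) \<open>P \<noteq> {}\<close>
    by (auto simp: V_def polytope_imp_compact polytope_imp_convex)
  then obtain v0 where "v0 \<in> V" by blast
  show "d \<le> m"
    using card_S[OF \<open>v0 \<in> V\<close>] card_mono[of \<F> "S v0"] \<open>finite \<F>\<close> by (auto simp: m S_def)
  have card_compl: "card (\<F> - S v) \<le> m - d" if "v \<in> V" for v
    using card_S[OF that] card_Diff_subset[OF finS[of v], of \<F>] by (auto simp: m S_def)
  define D where "D v = {i \<in> J v. 0 < w v i}" for v
  define U where "U v = {i \<in> J v. w v i < 0}" for v
  have finDU: "finite (D v)" "finite (U v)" if "v \<in> V" for v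
    using finJ[OF that] by (auto simp: D_def U_def)
  have sgn: "a i \<bullet> (x - v) \<le> 0" "x \<in> i \<Longrightarrow> a i \<bullet> (x - v) = 0" if "v \<in> V" "x \<in> P" "i \<in> J v" for v x i
  proof -
    have i: "i \<in> \<F>" "v \<in> i" using J(1)[OF that(1)] that(3) by (auto simp: S_def)
    then have "a i \<bullet> v = b i" using facet by blast
    then show "a i \<bullet> (x - v) \<le> 0" using half[OF i(1) that(2)] by (simp add: inner_simps)
    show "x \<in> i \<Longrightarrow> a i \<bullet> (x - v) = 0"
      using facet[OF i(1)] \<open>a i \<bullet> v = b i\<close> by (auto simp: inner_simps)
  qed
  \<comment> \<open>Expand \<open>c \<bullet> (x - v)\<close> in the normals at \<open>v\<close>.
    Terms of positive weight vanish because \<open>x\<close> lies on those facets; the others are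
    products of two nonpositive numbers.\<close>
  have min: "c \<bullet> v \<le> c \<bullet> x" if "v \<in> V" "x \<in> P" "D v \<subseteq> S x" for v x
  proof -
    have "0 \<le> (\<Sum>i\<in>J v. w v i * (a i \<bullet> (x - v)))"
    proof (rule sum_nonneg)
      fix i assume i: "i \<in> J v"
      show "0 \<le> w v i * (a i \<bullet> (x - v))"
      proof (cases "0 < w v i")
        case True
        then have "x \<in> i" using that(3) i by (auto simp: D_def S_def)
        then show ?thesis using sgn(2)[OF that(1,2) i] by simp
      next
        case False
        then show ?thesis using sgn(1)[OF that(1,2) i] by (simp add: mult_nonpos_nonpos)
      qed
    qed
    then have "0 \<le> c \<bullet> (x - v)" using w[OF that(1)] diffL VP that by simp
    then show ?thesis by (simp add: inner_simps)
  qed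
  have max: "c \<bullet> x \<le> c \<bullet> v" if "v \<in> V" "x \<in> P" "U v \<subseteq> S x" for v x
  proof -
    have "(\<Sum>i\<in>J v. w v i * (a i \<bullet> (x - v))) \<le> 0"
    proof (rule sum_nonpos)
      fix i assume i: "i \<in> J v"
      show "w v i * (a i \<bullet> (x - v)) \<le> 0"
      proof (cases "w v i < 0")
        case True
        then have "x \<in> i" using that(3) i by (auto simp: U_def S_def)
        then show ?thesis using sgn(2)[OF that(1,2) i] by simp
      next
        case False
        then show ?thesis using sgn(1)[OF that(1,2) i] by (simp add: mult_nonneg_nonpos)
      qed
    qed
    then have "c \<bullet> (x - v) \<le> 0" using w[OF that(1)] diffL VP that by simp
    then show ?thesis by (simp add: inner_simps)
  qed
  define p where "p = d div 2"
  \<comment> \<open>A vertex in neither \<open>V1\<close> nor \<open>V2\<close> would have at least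
    \<open>p + 1\<close> positive and \<open>d - p\<close> negative weights, more than
    \<open>d\<close> in total.\<close>
  define V1 where "V1 = {v \<in> V. card (D v) \<le> p}"
  define V2 where "V2 = {v \<in> V. card (U v) \<le> d - 1 - p}"
  have sub: "D v \<subseteq> S v" "U v \<subseteq> S v" "S v \<subseteq> \<F>" if "v \<in> V" for v
    using J(1)[OF that] by (auto simp: D_def U_def S_def)
  have disj: "D v \<inter> (\<F> - S v) = {}" "U v \<inter> (\<F> - S v) = {}" if "v \<in> V" for v
    using sub[OF that] by blast+
  have "V \<subseteq> V1 \<union> V2"
  proof
    fix v assume "v \<in> V"
    have "card (D v) + card (U v) = card (D v \<union> U v)"
      using finDU[OF \<open>v \<in> V\<close>] by (subst card_Un_disjoint) (auto simp: D_def U_def)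
    also have "\<dots> \<le> card (J v)"
      using finJ[OF \<open>v \<in> V\<close>] by (intro card_mono) (auto simp: D_def U_def)
    finally have "card (D v) + card (U v) \<le> d" using J(2) \<open>v \<in> V\<close> by simp
    then show "v \<in> V1 \<union> V2" using \<open>v \<in> V\<close> by (auto simp: V1_def V2_def)
  qed
  then have "card V \<le> card V1 + card V2"
    using \<open>finite V\<close> by (intro order_trans[OF card_mono card_Un_le]) (auto simp: V1_def V2_def)
  moreover have "card V1 \<le> (p + (m - d)) choose p"
  proof (rule skew_Bollobas[where A = D and B = "\<lambda>v. \<F> - S v" and f = "\<lambda>v. c \<bullet> v"])
    fix i j assume ij: "i \<in> V1" "j \<in> V1" "c \<bullet> j < c \<bullet> i"
    \<comment> \<open>Otherwise \<open>j\<close> would lie on all facets in \<open>D i\<close>, and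
      \<open>min\<close> would give \<open>c \<bullet> i \<le> c \<bullet> j\<close>.\<close>
    then have "\<not> D i \<subseteq> S j" using min[of i j] VP by (auto simp: V1_def)
    then show "D i \<inter> (\<F> - S j) \<noteq> {}" using sub[of i] ij by (auto simp: V1_def)
  next
    show "inj_on (\<lambda>v. c \<bullet> v) V1" using c by (rule inj_on_subset) (auto simp: V1_def)
  qed (use \<open>finite V\<close> \<open>finite \<F>\<close> finDU card_compl disj(1) in \<open>simp_all add: V1_def\<close>)
  moreover have "card V2 \<le> (d - 1 - p + (m - d)) choose (d - 1 - p)"
  proof (rule skew_Bollobas[where A = U and B = "\<lambda>v. \<F> - S v" and f = "\<lambda>v. - (c \<bullet> v)"])
    fix i j assume ij: "i \<in> V2" "j \<in> V2" "- (c \<bullet> j) < - (c \<bullet> i)"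
    then have "\<not> U i \<subseteq> S j" using max[of i j] VP by (auto simp: V2_def)
    then show "U i \<inter> (\<F> - S j) \<noteq> {}" using sub[of i] ij by (auto simp: V2_def)
  next
    show "inj_on (\<lambda>v. - (c \<bullet> v)) V2" using c by (auto simp: inj_on_def V2_def)
  qed (use \<open>finite V\<close> \<open>finite \<F>\<close> finDU card_compl disj(2) in \<open>simp_all add: V2_def\<close>)
  ultimately show "card {v. v extreme_point_of P} \<le> (m - d + d div 2 choose (d div 2))
      + (m - d + (d - 1 - d div 2) choose (d - 1 - d div 2))"
    by (simp add: V_def p_def add.commute)
qed

subsection \<open>Unimodality of the binomial bounds\<close>

text \<open>By the absorption identities both sides equal
  \<open>(n choose s) * (n - s) * Suc n\<close>. With \<open>n = M - r - 1\<close> and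
  \<open>s = r\<close> this is the ratio of consecutive values of \<open>h1\<close>.\<close>

lemma binomial_descent_identity:
  fixes n s :: nat
  assumes "s \<le> n"
  shows "(n choose Suc s) * (Suc s * Suc n) = (Suc n choose s) * ((Suc n - s) * (n - s))"
proof -
  have 1: "Suc s * (n choose Suc s) = (n choose s) * (n - s)"
    by (metis binomial_absorb_comp binomial_absorption mult.commute)
  have 2: "(Suc n choose s) * (Suc n - s) = Suc n * (n choose s)"
    using binomial_absorb_comp[of "Suc n" s] by (simp add: mult.commute)
  show ?thesis
    using 1 2 by (metis (no_types, lifting) mult.assoc mult.commute)
qed

lemma h1_step:
  fixes M r :: int
  assumes "0 \<le> r" "2 * (r + 1) \<le> M"
  shows "int (h1 M (r + 1)) * ((r + 1) * (M - r)) = int (h1 M r) * ((M - 2 * r) * (M - 2 * r - 1))"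
proof -
  define s where "s = nat r"
  define n where "n = nat (M - r - 1)"
  have r: "r = int s" and M: "M = int n + int s + 1" and sn: "s < n"
    using assms by (auto simp: s_def n_def)
  have "int (n choose Suc s) * (int (Suc s) * int (Suc n))
      = int (Suc n choose s) * (int (Suc n - s) * int (n - s))"
    using binomial_descent_identity[of s n] sn by (metis less_imp_le of_nat_mult)
  moreover have "h1 M (r + 1) = n choose Suc s" "h1 M r = Suc n choose s"
    using sn by (auto simp: h1_def binom_int_def r M nat_add_distrib)
  ultimately show ?thesis
    using sn by (simp add: r M of_nat_diff algebra_simps)
qed

lemma
  fixes M r :: int
  assumes "1 \<le> M"
  shows h1_le_h1_Suc: "real_of_int r < r11 M \<Longrightarrow> h1 M r \<le> h1 M (r + 1)"
    and h1_Suc_le_h1: "r11 M \<le> real_of_int r \<Longrightarrow> h1 M (r + 1) \<le> h1 M r"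
proof -
  define D where "D = 5 * (real_of_int M)\<^sup>2 + 10 * M + 9"
  define t where "t = 5 * real_of_int M - 3 - 10 * r"
  define Q where "Q = real_of_int ((M - 2 * r) * (M - 2 * r - 1) - (r + 1) * (M - r))"
  have D: "0 \<le> D" using assms by (simp add: D_def)
  \<comment> \<open>The sign of \<open>Q\<close> decides by \<open>h1_step\<close> whether
    \<open>h1\<close> rises or falls. Completing the square shows that \<open>Q\<close>, as a
    quadratic in \<open>r\<close>, has smaller root \<open>r11 M\<close>.\<close>
  have t: "t\<^sup>2 = D + 20 * Q"
    by (simp add: t_def D_def Q_def power2_eq_square algebra_simps)
  have r11: "r11 M = (5 * real_of_int M - 3 - sqrt D) / 10"
    by (simp add: r11_def D_def)
  show "h1 M r \<le> h1 M (r + 1)" if "real_of_int r < r11 M"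
  proof (cases "0 \<le> r")
    case False
    then show ?thesis by (simp add: h1_def binom_int_def)
  next
    case True
    have less: "sqrt D < t" using that by (simp add: r11 t_def)
    then have "(sqrt D)\<^sup>2 < t\<^sup>2" using D by (intro power_strict_mono) auto
    then have "0 < Q" using D t by simp
    then have Q: "(r + 1) * (M - r) < (M - 2 * r) * (M - 2 * r - 1)"
      unfolding Q_def by linarith
    have "0 < t" using less D by (meson order_le_less_trans real_sqrt_ge_zero)
    then have "2 * r < M" unfolding t_def by linarith
    \<comment> \<open>The only other possibility, \<open>2 * r = M - 1\<close>, makes the right side
      of \<open>Q\<close> zero.\<close>
    with Q assms True have "2 * (r + 1) \<le> M"
      by (smt (verit) mult_nonneg_nonneg mult_eq_0_iff)
    note h1_step[OF True this]
    moreover have "int (h1 M r) * ((r + 1) * (M - r))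
        \<le> int (h1 M r) * ((M - 2 * r) * (M - 2 * r - 1))"
      using Q by (intro mult_left_mono) auto
    moreover have "0 < (r + 1) * (M - r)"
      using True \<open>2 * r < M\<close> by simp
    ultimately have "int (h1 M r) \<le> int (h1 M (r + 1))"
      by (metis mult_le_cancel_right_pos)
    then show ?thesis by simp
  qed
  show "h1 M (r + 1) \<le> h1 M r" if "r11 M \<le> real_of_int r"
  proof (cases "0 \<le> r \<and> 2 * (r + 1) \<le> M")
    case False
    \<comment> \<open>At \<open>r = -1\<close> the value jumps from 0 to 1, so this \<open>r\<close>
      must be shown to lie below \<open>r11 M\<close>. In the remaining cases
      \<open>h1 M (r + 1)\<close> is 0.\<close>
    have "0 \<le> r11 M \<or> r + 1 \<noteq> 0"
    proof (rule ccontr)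
      assume "\<not> ?thesis"
      then have "r = -1" "r11 M \<le> -1" using that by auto
      then have "5 * real_of_int M + 7 \<le> sqrt D" by (simp add: r11)
      then have "(5 * real_of_int M + 7)\<^sup>2 \<le> (sqrt D)\<^sup>2"
        using assms by (intro power_mono) auto
      then have "(5 * real_of_int M + 7)\<^sup>2 \<le> D" using D by simp
      then show False using assms
        by (simp add: D_def power2_eq_square algebra_simps)
           (smt (verit) mult_nonneg_nonneg of_int_1_le_iff)
    qed
    then have "r + 1 < 0 \<or> M - (r + 1) < r + 1" using that False by (auto simp: not_le)
    then show ?thesis by (auto simp: h1_def binom_int_def)
  next
    case True
    \<comment> \<open>\<open>2 * (r + 1) \<le> M\<close> makes \<open>t\<close> positive, which
      keeps \<open>r\<close> below the larger root of \<open>Q\<close>.\<close>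
    have "0 \<le> t" "t \<le> sqrt D" using that True by (auto simp: r11 t_def)
    then have "t\<^sup>2 \<le> (sqrt D)\<^sup>2" by (intro power_mono)
    then have "Q \<le> 0" using D t by simp
    then have Q: "(M - 2 * r) * (M - 2 * r - 1) \<le> (r + 1) * (M - r)"
      unfolding Q_def by linarith
    have "int (h1 M (r + 1)) * ((r + 1) * (M - r)) \<le> int (h1 M r) * ((r + 1) * (M - r))"
      using True Q by (subst h1_step) (auto intro: mult_left_mono)
    moreover have "0 < (r + 1) * (M - r)" using True by simp
    ultimately show ?thesis by (metis mult_le_cancel_right_pos of_nat_le_iff)
  qed
qed

text \<open>\<open>h\<close> increases up to \<lceil>\<rho>\<rceil> and decreases afterwards. If
  \<lceil>\<rho>\<rceil> exceeds the cap \<open>K\<close>, then \<open>h\<close> is still increasing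
  up to \<open>K\<close>, and \<open>K\<close> is the best admissible argument.\<close>

lemma unimodal_le_max_at_peak:
  fixes h :: "int \<Rightarrow> nat" and \<rho> :: real
  assumes up: "\<And>r. real_of_int r < \<rho> \<Longrightarrow> h r \<le> h (r + 1)"
    and down: "\<And>r. \<rho> \<le> real_of_int r \<Longrightarrow> h (r + 1) \<le> h r"
    and "k \<le> K"
  shows "h k \<le> max (h (min \<lfloor>\<rho>\<rfloor> K)) (h (min \<lceil>\<rho>\<rceil> K))"
proof -
  have inc: "h k \<le> h l" if "k \<le> l" "l \<le> \<lceil>\<rho>\<rceil>" for l
    using that
  proof (induction l rule: int_ge_induct)
    case (step i)
    then have "real_of_int i < \<rho>" by linarith
    then show ?case using up[of i] step by simp
  qed simp
  have dec: "h l \<le> h \<lceil>\<rho>\<rceil>" if "\<lceil>\<rho>\<rceil> \<le> l" for l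
    using that
  proof (induction l rule: int_ge_induct)
    case (step i)
    then have "\<rho> \<le> real_of_int i" by linarith
    then show ?case using down[of i] step by simp
  qed simp
  show ?thesis
  proof (cases "\<lceil>\<rho>\<rceil> \<le> K")
    case True
    then have "h k \<le> h (min \<lceil>\<rho>\<rceil> K)"
      using inc[of "\<lceil>\<rho>\<rceil>"] dec[of k] by (cases "k \<le> \<lceil>\<rho>\<rceil>") auto
    then show ?thesis by simp
  next
    case False
    then have "h k \<le> h (min \<lceil>\<rho>\<rceil> K)" using inc[of K] assms(3) by simp
    then show ?thesis by simp
  qed
qed

lemma h1_le_h111:
  assumes "1 \<le> M" "k \<le> N div 2"
  shows "h1 M (int k) \<le> h111 N M"
  unfolding h111_def hij1_def
  by (rule unimodal_le_max_at_peak)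
     (use assms h1_le_h1_Suc h1_Suc_le_h1 in auto)

lemma h2_eq_h1: "h2 M r = h1 (M - 1) (r - 1)"
  by (simp add: h1_def h2_def)

text \<open>Since \<open>5 * (M - 1)^2 + 10 * (M - 1) + 9 = 5 * M^2 + 4\<close>, the peak moves by
  the same shift that turns \<open>h1\<close> into \<open>h2\<close>, and unimodality of
  \<open>h2\<close> follows from that of \<open>h1\<close>.\<close>

lemma r21_eq_r11: "r21 M = r11 (M - 1) + 1"
  by (simp add: r11_def r21_def power2_eq_square field_simps)

lemma h2_le_h221:
  assumes "2 \<le> M" "k \<le> N div 2"
  shows "h2 M (int k) \<le> h221 N M"
  unfolding h221_def hij1_def
proof (rule unimodal_le_max_at_peak)
  fix r :: int
  show "h2 M r \<le> h2 M (r + 1)" if "real_of_int r < r21 M"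
    using that h1_le_h1_Suc[of "M - 1" "r - 1"] assms by (simp add: h2_eq_h1 r21_eq_r11)
  show "h2 M (r + 1) \<le> h2 M r" if "r21 M \<le> real_of_int r"
    using that h1_Suc_le_h1[of "M - 1" "r - 1"] assms by (simp add: h2_eq_h1 r21_eq_r11)
qed (use assms in auto)

section \<open>Even and odd dimension compared with \<open>Lambda\<close>\<close>

lemma upper_bound_le_Lambda:
  fixes N m d :: nat
  assumes "3 \<le> m" "1 \<le> d" "d \<le> m" "d \<le> N"
  shows "(m - d + d div 2 choose (d div 2)) + (m - d + (d - 1 - d div 2) choose (d - 1 - d div 2))
    \<le> Lambda N m"
proof (cases "even d")
  case True
  then obtain k where d: "d = 2 * k" by blast
  \<comment> \<open>\<open>h111\<close> and \<open>h221\<close> dominate the values at every such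
    \<open>k \<le> N div 2\<close>, so polytopes of dimension \<open>d < N\<close> are covered as
    well.\<close>
  have "1 \<le> k" "k \<le> N div 2" "2 * k \<le> m" using assms d by auto
  have "m - d + d div 2 choose (d div 2) = h1 (int m) (int k)"
    using \<open>2 * k \<le> m\<close> by (auto simp: h1_def binom_int_def d nat_diff_distrib' intro!: arg_cong2[of _ _ _ _ binomial])
  moreover have "m - d + (d - 1 - d div 2) choose (d - 1 - d div 2) = h2 (int m - 1) (int k)"
    using \<open>2 * k \<le> m\<close> \<open>1 \<le> k\<close> by (auto simp: h2_def binom_int_def d intro!: arg_cong2[of _ _ _ _ binomial])
  moreover have "h1 (int m) (int k) \<le> h111 N (int m)" "h2 (int m - 1) (int k) \<le> h221 N (int m - 1)"
    using assms \<open>k \<le> N div 2\<close> by (auto intro!: h1_le_h111 h2_le_h221)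
  ultimately show ?thesis by (simp add: Lambda_def)
next
  case False
  then obtain k where d: "d = 2 * k + 1" by (auto elim: oddE)
  \<comment> \<open>Here \<open>d - 1 - d div 2 = d div 2 = k\<close>, so the two summands
    coincide.\<close>
  have "k \<le> N div 2" "2 * k + 1 \<le> m" using assms d by auto
  have "m - d + k choose k = h1 (int m - 1) (int k)"
    using \<open>2 * k + 1 \<le> m\<close> by (auto simp: h1_def binom_int_def d intro!: arg_cong2[of _ _ _ _ binomial])
  moreover have "h1 (int m - 1) (int k) \<le> h111 N (int m - 1)"
    using assms \<open>k \<le> N div 2\<close> by (auto intro!: h1_le_h111)
  ultimately show ?thesis by (simp add: Lambda_def d)
qed

theorem mainTheorem1:
  fixes P :: "(real ^ 'N) set" and m :: nat
  assumes "m \<ge> 3"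
    and "polytope P"
    and "card {F. F facet_of P} = m"
  shows "card {v. v extreme_point_of P} \<le> Lambda CARD('N) m"
proof -
  \<comment> \<open>As \<open>m\<close> is positive there is a facet; being nonempty and of
    codimension one, it forces \<open>aff_dim P\<close> to be at least 1.\<close>
  have "{F. F facet_of P} \<noteq> {}" using assms(1,3) by force
  then obtain F where F: "F face_of P" "F \<noteq> {}" "aff_dim F = aff_dim P - 1"
    by (auto simp: facet_of_def)
  then have "0 \<le> aff_dim F" by (metis aff_dim_negative_iff not_less)
  with F(3) have "1 \<le> aff_dim P" by simp
  then obtain d where d: "aff_dim P = int d" "1 \<le> d"
    by (metis nonneg_int_cases of_nat_1 of_nat_le_iff order_trans zero_le_one)
  have "d \<le> CARD('N)" using aff_dim_le_DIM[of P] d(1) by simp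
  then show ?thesis
    using card_extreme_points_le[OF assms(2) d(1) assms(3)]
      upper_bound_le_Lambda[OF assms(1) d(2)] order_trans by blast
qed

end
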